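(* Let $v,d\ge 1$ be integers. An approximate block design $\xi$ (for test treatments $1,\dots,v$, control $0$ and $d$ blocks) is $E$-optimal for treatment-control comparisons if and only if $$\xi(0,k)=\frac{s_k(\xi)}{2}\ \text{ for all } k=1,\dots,d \quad\text{and}\quad r_1(\xi)=\cdots=r_v(\xi)=\frac{1}{2v}.$$
   Context: Treatments are labelled $0,1,\dots,v$, where $0$ is the control and $1,\dots,v$ are the test treatments; blocks are labelled $1,\dots,d$. An approximate (block) design is a function $\xi:\{0,\dots,v\}\times\{1,\dots,d\}\to[0,1]$ with $\sum_{i,k}\xi(i,k)=1$ such that every block has positive size, i.e. $s_k(\xi):=\sum_{i=0}^v\xi(i,k)>0$ for all $k$ (the block sizes are otherwise not fixed). Put $s=s(\xi)=(s_1,\dots,s_d)^T$, $s^{-1}=(s_1^{-1},\dots,s_d^{-1})$ and $r_i(\xi)=\sum_{k=1}^d\xi(i,k)$, $r=(r_0,\dots,r_v)^T$. Let $X(\xi)=(\xi(i,k))_{0\le i\le v,\,1\le k\le d}$ and $Z(\xi)=(\xi(i,k))_{1\le i\le v,\,1\le k\le d}$. Let $M(\xi)=\mathrm{diag}(r)-X\,\mathrm{diag}(s^{-1})X^T$ (a $(v+1)\times(v+1)$ matrix) and $Q=(-1_v,I_v)^T$, where $1_v$ is the all-ones vector, so that $Q^T\tau=(\tau_1-\tau_0,\dots,\tau_v-\tau_0)^T$ for the vector $\tau=(\tau_0,\dots,\tau_v)^T$ of treatment effects. The design $\xi$ is feasible if the column space of $Q$ is contained in the column space of $M(\xi)$.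 The information matrix of $\xi$ for treatment-control comparisons is the $v\times v$ matrix $$N(\xi)=\mathrm{diag}(r_1,\dots,r_v)-Z\,\mathrm{diag}(s^{-1})Z^T,$$ which is nonsingular when $\xi$ is feasible. A feasible approximate design is $E$-optimal (for treatment-control comparisons) if it minimizes the largest eigenvalue of $N^{-1}(\xi)$ (equivalently, maximizes the smallest eigenvalue of $N(\xi)$) among all feasible approximate designs with the given $v$ and $d$. *)

theory Defs
  imports
    "Jordan_Normal_Form.Matrix"
    "Jordan_Normal_Form.VS_Connect"
    "Jordan_Normal_Form.Gauss_Jordan_Elimination"
    "Jordan_Normal_Form.Spectral_Radius"
begin

text \<open>
  A design is a curried real function \<open>\<xi>\<close> of which only the values \<open>\<xi> i k\<close> with
  treatment label \<open>i \<in> {0..v}\<close> and block label \<open>k \<in> {1..d}\<close> matter; no definition below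
  looks at any other value. Vectors and matrices are indexed from 0, so block \<open>k\<close> is column
  \<open>k - 1\<close>; treatment \<open>i\<close> is index \<open>i\<close> where the control is included, and index \<open>i - 1\<close> where
  it is not.
\<close>

type_synonym design = "nat \<Rightarrow> nat \<Rightarrow> real"

definition block_size :: "nat \<Rightarrow> design \<Rightarrow> nat \<Rightarrow> real" where
  "block_size v \<xi> k = (\<Sum>i=0..v. \<xi> i k)"

definition replication :: "nat \<Rightarrow> design \<Rightarrow> nat \<Rightarrow> real" where
  "replication d \<xi> i = (\<Sum>k=1..d. \<xi> i k)"

definition approx_design :: "nat \<Rightarrow> nat \<Rightarrow> design \<Rightarrow> bool" where
  "approx_design v d \<xi> \<longleftrightarrow>
     (\<forall>i\<in>{0..v}. \<forall>k\<in>{1..d}. 0 \<le> \<xi> i k \<and> \<xi> i k \<le> 1) \<and>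
     (\<Sum>i=0..v. \<Sum>k=1..d. \<xi> i k) = 1 \<and>
     (\<forall>k\<in>{1..d}. block_size v \<xi> k > 0)"

definition X_mat :: "nat \<Rightarrow> nat \<Rightarrow> design \<Rightarrow> real mat" where
  "X_mat v d \<xi> = mat (v + 1) d (\<lambda>(i, k). \<xi> i (k + 1))"

definition Z_mat :: "nat \<Rightarrow> nat \<Rightarrow> design \<Rightarrow> real mat" where
  "Z_mat v d \<xi> = mat v d (\<lambda>(i, k). \<xi> (i + 1) (k + 1))"

definition inv_size_diag :: "nat \<Rightarrow> nat \<Rightarrow> design \<Rightarrow> real mat" where
  "inv_size_diag v d \<xi> = mat_diag d (\<lambda>k. inverse (block_size v \<xi> (k + 1)))"

definition M_mat :: "nat \<Rightarrow> nat \<Rightarrow> design \<Rightarrow> real mat" where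
  "M_mat v d \<xi> =
     mat_diag (v + 1) (\<lambda>i. replication d \<xi> i)
       - X_mat v d \<xi> * inv_size_diag v d \<xi> * transpose_mat (X_mat v d \<xi>)"

definition Q_mat :: "nat \<Rightarrow> real mat" where
  "Q_mat v = mat (v + 1) v (\<lambda>(i, j). if i = 0 then -1 else if i = j + 1 then 1 else 0)"

definition feasible :: "nat \<Rightarrow> nat \<Rightarrow> design \<Rightarrow> bool" where
  "feasible v d \<xi> \<longleftrightarrow>
     vec_space.col_space (v + 1) (Q_mat v) \<subseteq> vec_space.col_space (v + 1) (M_mat v d \<xi>)"

definition N_mat :: "nat \<Rightarrow> nat \<Rightarrow> design \<Rightarrow> real mat" where
  "N_mat v d \<xi> =
     mat_diag v (\<lambda>i. replication d \<xi> (i + 1))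
       - Z_mat v d \<xi> * inv_size_diag v d \<xi> * transpose_mat (Z_mat v d \<xi>)"

text \<open>
  \<open>mat_inverse\<close> returns an option. It is \<open>Some\<close> of the inverse whenever \<open>N_mat v d \<xi>\<close> is
  nonsingular, hence for every feasible design, and only feasible designs are compared below.
\<close>

definition N_inv :: "nat \<Rightarrow> nat \<Rightarrow> design \<Rightarrow> real mat" where
  "N_inv v d \<xi> = the (mat_inverse (N_mat v d \<xi>))"

text \<open>
  Only meaningful when the real spectrum is finite and nonempty, as it is for a symmetric matrix
  of positive dimension.
\<close>

definition largest_eigenvalue :: "real mat \<Rightarrow> real" where
  "largest_eigenvalue A = Max {c. eigenvalue A c}"

definition E_optimal :: "nat \<Rightarrow> nat \<Rightarrow> design \<Rightarrow> bool" where
  "E_optimal v d \<xi> \<longleftrightarrow>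
     approx_design v d \<xi> \<and> feasible v d \<xi> \<and>
     (\<forall>\<eta>. approx_design v d \<eta> \<and> feasible v d \<eta> \<longrightarrow>
        largest_eigenvalue (N_inv v d \<xi>) \<le> largest_eigenvalue (N_inv v d \<eta>))"

end

theory Submission
  imports Defs
begin

text \<open>
  The largest eigenvalue of \<open>N\<inverse>\<close> is the reciprocal of the smallest eigenvalue of \<open>N\<close>, and the
  latter is the minimum of the Rayleigh quotient of \<open>N\<close>. The argument compares this minimum with
  the value of the quotient at the all-ones vector \<open>1\<close>.

  The proof has two estimates of the quadratic form. On the one hand, block \<open>k\<close> contributes
  \<open>\<xi>(0,k) (s\<^sub>k - \<xi>(0,k)) / s\<^sub>k \<le> s\<^sub>k / 4\<close> to \<open>1\<^sup>T N 1\<close>, with equality exactly when the control takes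
  half of the block. As the block sizes sum to 1, \<open>1\<^sup>T N 1 \<le> 1/4\<close>, and since \<open>1\<^sup>T 1 = v\<close>, no design
  has a smallest eigenvalue above \<open>1/(4v)\<close> (\<open>N_mat_ones\<close>, \<open>largest_eigenvalue_ge\<close>).
  On the other hand, Cauchy-Schwarz in each block bounds \<open>x\<^sup>T N x\<close> below by
  \<open>\<Sum>\<^sub>k \<xi>(0,k)/s\<^sub>k \<Sum>\<^sub>i \<xi>(i,k) x\<^sub>i\<^sup>2\<close> (\<open>N_mat_quadratic_form_ge\<close>). If the control takes half of every
  block and all test treatments have replication \<open>1/(2v)\<close>, this bound is \<open>x\<^sup>T x / (4v)\<close>, so the
  value \<open>1/(4v)\<close> is reached. The uniform design of this kind exists for all \<open>v\<close> and \<open>d\<close>; hence a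
  design is optimal exactly when it is feasible and its smallest eigenvalue is \<open>1/(4v)\<close>.

  Conversely, let the smallest eigenvalue be \<open>1/(4v)\<close>. Then \<open>1\<^sup>T N 1 = 1/4\<close>, which forces the control
  to take half of every block, and \<open>1\<close> minimizes the Rayleigh quotient, so it is an eigenvector:
  \<open>N 1 = 1/(4v) 1\<close>. With half-control blocks the entries of \<open>N 1\<close> are \<open>r\<^sub>i / 2\<close>, which gives the
  replications (\<open>largest_eigenvalue_min_imp_balanced\<close>).

  Two facts support this. The infimum of the Rayleigh quotient of a real symmetric matrix is one of
  its eigenvalues (\<open>symmetric_least_eigenvalue\<close>). Feasibility means precisely that \<open>N\<close> is nonsingular
  (\<open>feasible_iff_nonsingular\<close>), because \<open>N\<close> is the block of \<open>M\<close> left after removing the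
  control and the rows and columns of \<open>M\<close> sum to zero.
\<close>

section \<open>Rayleigh quotients of real symmetric matrices\<close>

lemma scalar_prod_sum: "x \<in> carrier_vec n \<Longrightarrow> y \<in> carrier_vec n \<Longrightarrow>
    x \<bullet> y = (\<Sum>i<n. x $ i * y $ i)"
  by (auto simp: scalar_prod_def atLeast0LessThan)

lemma mult_mat_vec_sum: "A \<in> carrier_mat m n \<Longrightarrow> x \<in> carrier_vec n \<Longrightarrow> i < m \<Longrightarrow>
    (A *\<^sub>v x) $ i = (\<Sum>j<n. A $$ (i, j) * x $ j)"
  by (auto simp: scalar_prod_def atLeast0LessThan)

lemma scalar_prod_self_nonneg: "0 \<le> (x :: real vec) \<bullet> x"
  by (auto simp: scalar_prod_def intro: sum_nonneg)

lemma scalar_prod_self_pos: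
  assumes "(x :: real vec) \<in> carrier_vec n" "x \<noteq> 0\<^sub>v n"
  shows "0 < x \<bullet> x"
proof -
  obtain i where i: "i < n" "x $ i \<noteq> 0" using assms by (auto simp: vec_eq_iff)
  have "0 < (\<Sum>i<n. x $ i * x $ i)"
    by (rule sum_pos2[of _ i]) (use i in \<open>auto simp: less_le\<close>)
  then show ?thesis using assms by (simp add: scalar_prod_sum)
qed

lemma quadratic_form_bounded:
  fixes A :: "real mat"
  assumes A: "A \<in> carrier_mat n n"
  obtains C where "C > 0" "\<And>x. x \<in> carrier_vec n \<Longrightarrow> x \<bullet> (A *\<^sub>v x) \<le> C * (x \<bullet> x)"
proof
  let ?C = "1 + (\<Sum>i<n. \<Sum>j<n. \<bar>A $$ (i, j)\<bar>)"
  show "?C > 0" by (rule add_pos_nonneg) (auto intro!: sum_nonneg)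
  fix x :: "real vec" assume x: "x \<in> carrier_vec n"
  have sq: "(x $ i)\<^sup>2 \<le> x \<bullet> x" if "i < n" for i
    using member_le_sum[of i "{..<n}" "\<lambda>i. (x $ i)\<^sup>2"] that x
    by (simp add: scalar_prod_sum power2_eq_square)
  have prod: "\<bar>x $ i * x $ j\<bar> \<le> x \<bullet> x" if "i < n" "j < n" for i j
  proof -
    have "2 * \<bar>x $ i * x $ j\<bar> \<le> (x $ i)\<^sup>2 + (x $ j)\<^sup>2"
      using sum_squares_bound[of "\<bar>x $ i\<bar>" "\<bar>x $ j\<bar>"] by (simp add: abs_mult)
    with sq[OF that(1)] sq[OF that(2)] show ?thesis by linarith
  qed
  have "x \<bullet> (A *\<^sub>v x) = (\<Sum>i<n. \<Sum>j<n. A $$ (i, j) * (x $ i * x $ j))"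
    using A x by (subst scalar_prod_sum[of _ n])
      (auto simp: mult_mat_vec_sum sum_distrib_left mult_ac simp del: index_mult_mat_vec
        intro!: sum.cong)
  also have "\<dots> \<le> (\<Sum>i<n. \<Sum>j<n. \<bar>A $$ (i, j)\<bar> * (x \<bullet> x))"
  proof (intro sum_mono)
    fix i j assume "i \<in> {..<n}" "j \<in> {..<n}"
    then have "\<bar>A $$ (i, j) * (x $ i * x $ j)\<bar> \<le> \<bar>A $$ (i, j)\<bar> * (x \<bullet> x)"
      unfolding abs_mult[of "A $$ (i, j)"] by (intro mult_left_mono prod) auto
    then show "A $$ (i, j) * (x $ i * x $ j) \<le> \<bar>A $$ (i, j)\<bar> * (x \<bullet> x)" by linarith
  qed
  also have "\<dots> \<le> ?C * (x \<bullet> x)"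
    by (simp add: sum_distrib_right distrib_right scalar_prod_self_nonneg)
  finally show "x \<bullet> (A *\<^sub>v x) \<le> ?C * (x \<bullet> x)" .
qed

lemma symmetric_scalar_prod:
  fixes A :: "real mat"
  assumes "A \<in> carrier_mat n n" "A\<^sup>T = A" "x \<in> carrier_vec n" "y \<in> carrier_vec n"
  shows "x \<bullet> (A *\<^sub>v y) = (A *\<^sub>v x) \<bullet> y"
  using transpose_vec_mult_scalar[of A n n y x] assms by simp

text \<open>
  Positive semidefiniteness is tested at the single point \<open>x - A x / C\<close>, where \<open>C\<close> bounds the quadratic
  form of \<open>A\<close>. The resulting inequality gives both the kernel of a positive semidefinite form and the
  coercivity of a nonsingular one.
\<close>

lemma psd_image_bound:
  fixes A :: "real mat"
  assumes A: "A \<in> carrier_mat n n" and sym: "A\<^sup>T = A"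
    and psd: "\<And>x. x \<in> carrier_vec n \<Longrightarrow> 0 \<le> x \<bullet> (A *\<^sub>v x)"
  obtains C where "C > 0"
    "\<And>x. x \<in> carrier_vec n \<Longrightarrow> (A *\<^sub>v x) \<bullet> (A *\<^sub>v x) \<le> C * (x \<bullet> (A *\<^sub>v x))"
proof -
  obtain C where C: "C > 0" "\<And>x. x \<in> carrier_vec n \<Longrightarrow> x \<bullet> (A *\<^sub>v x) \<le> C * (x \<bullet> x)"
    using quadratic_form_bounded[OF A] by blast
  show thesis
  proof (rule that[OF C(1)])
    fix x :: "real vec" assume x: "x \<in> carrier_vec n"
    define y where "y = A *\<^sub>v x"
    have y: "y \<in> carrier_vec n" "A *\<^sub>v y \<in> carrier_vec n" using A x by (auto simp: y_def)
    \<comment> \<open>The step \<open>1 / C\<close> lets the quadratic term cancel at most half of the linear one.\<close>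
    let ?z = "x - (1 / C) \<cdot>\<^sub>v y"
    have Az: "A *\<^sub>v ?z = y - (1 / C) \<cdot>\<^sub>v (A *\<^sub>v y)"
      using A x y by (simp add: mult_minus_distrib_mat_vec mult_mat_vec y_def)
    have xy: "x \<bullet> (A *\<^sub>v y) = y \<bullet> y"
      using symmetric_scalar_prod[OF A sym x y(1)] by (simp add: y_def)
    have "0 \<le> ?z \<bullet> (A *\<^sub>v ?z)" using x y by (intro psd) auto
    also have "\<dots> = x \<bullet> y - 1 / C * (y \<bullet> y) - 1 / C * (y \<bullet> y - 1 / C * (y \<bullet> (A *\<^sub>v y)))"
      unfolding Az using x y xy
      by (simp add: minus_scalar_prod_distrib[of _ n] scalar_prod_minus_distrib[of _ n] algebra_simps)
    finally have "0 \<le> C * (x \<bullet> y - 1 / C * (y \<bullet> y) - 1 / C * (y \<bullet> y - 1 / C * (y \<bullet> (A *\<^sub>v y))))"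
      using C(1) by simp
    also have "\<dots> = C * (x \<bullet> y) - 2 * (y \<bullet> y) + (y \<bullet> (A *\<^sub>v y)) / C"
      using C(1) by (simp add: field_simps)
    also have "(y \<bullet> (A *\<^sub>v y)) / C \<le> y \<bullet> y" using C(2)[OF y(1)] C(1) by (simp add: field_simps)
    finally show "(A *\<^sub>v x) \<bullet> (A *\<^sub>v x) \<le> C * (x \<bullet> (A *\<^sub>v x))" unfolding y_def by simp
  qed
qed

lemma psd_kernel:
  fixes A :: "real mat"
  assumes A: "A \<in> carrier_mat n n" and sym: "A\<^sup>T = A"
    and psd: "\<And>x. x \<in> carrier_vec n \<Longrightarrow> 0 \<le> x \<bullet> (A *\<^sub>v x)"
    and x: "x \<in> carrier_vec n" and zero: "x \<bullet> (A *\<^sub>v x) = 0"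
  shows "A *\<^sub>v x = 0\<^sub>v n"
proof (rule ccontr)
  assume "A *\<^sub>v x \<noteq> 0\<^sub>v n"
  then have pos: "0 < (A *\<^sub>v x) \<bullet> (A *\<^sub>v x)" using A x by (intro scalar_prod_self_pos) auto
  obtain C where "C > 0" "(A *\<^sub>v x) \<bullet> (A *\<^sub>v x) \<le> C * (x \<bullet> (A *\<^sub>v x))"
    using psd_image_bound[OF A sym psd] x by metis
  with pos zero show False by simp
qed

lemma nonsingular_inverse:
  fixes A :: "real mat"
  assumes A: "A \<in> carrier_mat n n" and "det A \<noteq> 0"
  obtains B where "mat_inverse A = Some B" "B \<in> carrier_mat n n" "A * B = 1\<^sub>m n" "B * A = 1\<^sub>m n"
proof -
  have "A \<in> Units (ring_mat TYPE(real) n ())" by (rule det_non_zero_imp_unit[OF assms])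
  then obtain B where "mat_inverse A = Some B" using mat_inverse(1)[OF A] by fastforce
  with mat_inverse(2)[OF A this] that show thesis by blast
qed

text \<open>
  The inverse \<open>B\<close> is bounded, so \<open>|x|\<^sup>2 = |B (A x)|\<^sup>2\<close> is at most a multiple of \<open>|A x|\<^sup>2\<close>, and hence of
  \<open>x\<^sup>T A x\<close>.
\<close>

lemma nonsingular_psd_coercive:
  fixes A :: "real mat"
  assumes A: "A \<in> carrier_mat n n" and sym: "A\<^sup>T = A"
    and psd: "\<And>x. x \<in> carrier_vec n \<Longrightarrow> 0 \<le> x \<bullet> (A *\<^sub>v x)" and det: "det A \<noteq> 0"
  obtains c where "c > 0" "\<And>x. x \<in> carrier_vec n \<Longrightarrow> c * (x \<bullet> x) \<le> x \<bullet> (A *\<^sub>v x)"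
proof -
  obtain B where B: "B \<in> carrier_mat n n" "B * A = 1\<^sub>m n" using nonsingular_inverse[OF A det] by metis
  obtain C where C: "C > 0"
    "\<And>x. x \<in> carrier_vec n \<Longrightarrow> (A *\<^sub>v x) \<bullet> (A *\<^sub>v x) \<le> C * (x \<bullet> (A *\<^sub>v x))"
    using psd_image_bound[OF A sym psd] by metis
  obtain D where D: "D > 0"
    "\<And>y. y \<in> carrier_vec n \<Longrightarrow> y \<bullet> (B\<^sup>T * B *\<^sub>v y) \<le> D * (y \<bullet> y)"
    using quadratic_form_bounded[of "B\<^sup>T * B" n] B by auto
  show thesis
  proof (rule that[of "1 / (D * C)"])
    show "1 / (D * C) > 0" using C D by simp
    fix x :: "real vec" assume x: "x \<in> carrier_vec n"
    define y where "y = A *\<^sub>v x"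
    have y: "y \<in> carrier_vec n" "B *\<^sub>v y = x"
      using A B x by (auto simp: y_def assoc_mult_mat_vec[symmetric, of _ n n _ n])
    have "B\<^sup>T * B *\<^sub>v y = B\<^sup>T *\<^sub>v x" using B y by (simp add: assoc_mult_mat_vec[of _ n n _ n])
    then have "y \<bullet> (B\<^sup>T * B *\<^sub>v y) = x \<bullet> x"
      using transpose_vec_mult_scalar[of B n n y x] B x y
      by (simp add: comm_scalar_prod[of y n])
    then have "x \<bullet> x \<le> D * (y \<bullet> y)" using D(2)[OF y(1)] by simp
    also have "\<dots> \<le> D * (C * (x \<bullet> (A *\<^sub>v x)))"
      using C(2)[OF x] D(1) by (simp add: y_def)
    finally show "1 / (D * C) * (x \<bullet> x) \<le> x \<bullet> (A *\<^sub>v x)"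
      using C D by (simp add: field_simps)
  qed
qed

lemma char_matrix_mult_vec:
  fixes A :: "real mat"
  assumes "A \<in> carrier_mat n n" "x \<in> carrier_vec n"
  shows "char_matrix A \<mu> *\<^sub>v x = A *\<^sub>v x - \<mu> \<cdot>\<^sub>v x"
  using assms unfolding char_matrix_def
  by (intro eq_vecI) (auto simp: add_scalar_prod_distrib[of _ n])

lemma char_matrix_quadratic_form:
  fixes A :: "real mat"
  assumes "A \<in> carrier_mat n n" "x \<in> carrier_vec n"
  shows "x \<bullet> (char_matrix A \<mu> *\<^sub>v x) = x \<bullet> (A *\<^sub>v x) - \<mu> * (x \<bullet> x)"
  using assms by (simp add: char_matrix_mult_vec scalar_prod_minus_distrib[of _ n])

lemma char_matrix_symmetric:
  fixes A :: "real mat"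
  assumes "A \<in> carrier_mat n n" "A\<^sup>T = A"
  shows "(char_matrix A \<mu>)\<^sup>T = char_matrix A \<mu>"
proof -
  have "(- \<mu> \<cdot>\<^sub>m 1\<^sub>m n)\<^sup>T = (- \<mu> \<cdot>\<^sub>m 1\<^sub>m n :: real mat)" by (intro eq_matI) auto
  then show ?thesis using assms unfolding char_matrix_def by (simp add: transpose_add[of _ n n])
qed

text \<open>
  Let \<open>\<mu>\<close> be the infimum of the Rayleigh quotient. Then \<open>A - \<mu> I\<close> is positive semidefinite. If it were
  nonsingular, it would be coercive, and the quotient would stay above \<open>\<mu> + c\<close> for some \<open>c > 0\<close>.
  This replaces the usual compactness argument on the unit sphere by algebra.
\<close>

theorem symmetric_least_eigenvalue:
  fixes A :: "real mat"
  assumes A: "A \<in> carrier_mat n n" and sym: "A\<^sup>T = A" and n: "n > 0"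
  obtains \<mu> where "eigenvalue A \<mu>" "\<And>x. x \<in> carrier_vec n \<Longrightarrow> \<mu> * (x \<bullet> x) \<le> x \<bullet> (A *\<^sub>v x)"
proof -
  define S where "S = (\<lambda>x. x \<bullet> (A *\<^sub>v x) / (x \<bullet> x)) ` (carrier_vec n - {0\<^sub>v n})"
  define \<mu> where "\<mu> = Inf S"
  have "unit_vec n 0 \<in> carrier_vec n - {0\<^sub>v n :: real vec}"
    using n by (auto simp: vec_eq_iff)
  then have ne: "S \<noteq> {}" unfolding S_def by blast
  obtain C where C: "\<And>x. x \<in> carrier_vec n \<Longrightarrow> x \<bullet> ((- A) *\<^sub>v x) \<le> C * (x \<bullet> x)"
    using quadratic_form_bounded[of "- A" n] A by auto
  have "- C \<le> s" if "s \<in> S" for s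
  proof -
    obtain x where x: "x \<in> carrier_vec n" "x \<noteq> 0\<^sub>v n" "s = x \<bullet> (A *\<^sub>v x) / (x \<bullet> x)"
      using \<open>s \<in> S\<close> by (auto simp: S_def)
    have "x \<bullet> ((- A) *\<^sub>v x) = - (x \<bullet> (A *\<^sub>v x))"
      using A x(1) by (simp add: uminus_mult_mat_vec)
    with C[OF x(1)] have "- C * (x \<bullet> x) \<le> x \<bullet> (A *\<^sub>v x)" by simp
    with scalar_prod_self_pos[OF x(1,2)] show ?thesis by (simp add: x(3) pos_le_divide_eq)
  qed
  then have bdd: "bdd_below S" by (rule bdd_belowI)
  have lower: "\<mu> * (x \<bullet> x) \<le> x \<bullet> (A *\<^sub>v x)" if x: "x \<in> carrier_vec n" for x
  proof (cases "x = 0\<^sub>v n")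
    case True
    then show ?thesis using A by simp
  next
    case False
    then have "\<mu> \<le> x \<bullet> (A *\<^sub>v x) / (x \<bullet> x)"
      unfolding \<mu>_def using x bdd by (intro cInf_lower) (auto simp: S_def)
    with scalar_prod_self_pos[OF x False] show ?thesis by (simp add: pos_le_divide_eq)
  qed
  have "eigenvalue A \<mu>"
  proof (rule ccontr)
    assume "\<not> eigenvalue A \<mu>"
    then have "det (char_matrix A \<mu>) \<noteq> 0" using eigenvalue_det[OF A] by simp
    then obtain c where c: "c > 0"
      "\<And>x. x \<in> carrier_vec n \<Longrightarrow> c * (x \<bullet> x) \<le> x \<bullet> (char_matrix A \<mu> *\<^sub>v x)"
      using nonsingular_psd_coercive[of "char_matrix A \<mu>" n] A sym lower
      by (auto simp: char_matrix_symmetric char_matrix_quadratic_form)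
    have "\<mu> + c \<le> s" if "s \<in> S" for s
    proof -
      obtain x where x: "x \<in> carrier_vec n" "x \<noteq> 0\<^sub>v n" "s = x \<bullet> (A *\<^sub>v x) / (x \<bullet> x)"
        using \<open>s \<in> S\<close> by (auto simp: S_def)
      have "(\<mu> + c) * (x \<bullet> x) \<le> x \<bullet> (A *\<^sub>v x)"
        using c(2)[OF x(1)] A x(1) by (simp add: char_matrix_quadratic_form distrib_right)
      with scalar_prod_self_pos[OF x(1,2)] show ?thesis by (simp add: x(3) pos_le_divide_eq)
    qed
    then have "\<mu> + c \<le> \<mu>" unfolding \<mu>_def using ne by (intro cInf_greatest)
    with c(1) show False by simp
  qed
  with lower that show thesis by blast
qed

lemma eigenvalue_inverse_iff:
  fixes A B :: "real mat"
  assumes A: "A \<in> carrier_mat n n" and B: "B \<in> carrier_mat n n"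
    and AB: "A * B = 1\<^sub>m n" and BA: "B * A = 1\<^sub>m n"
  shows "eigenvalue B c \<longleftrightarrow> c \<noteq> 0 \<and> eigenvalue A (1 / c)"
proof -
  have *: "c \<noteq> 0 \<and> eigenvalue A (1 / c)"
    if m: "eigenvalue B c" "A \<in> carrier_mat n n" "B \<in> carrier_mat n n" "A * B = 1\<^sub>m n"
    for A B :: "real mat" and c
  proof -
    obtain x where x: "x \<in> carrier_vec n" "x \<noteq> 0\<^sub>v n" "B *\<^sub>v x = c \<cdot>\<^sub>v x"
      using m by (auto simp: eigenvalue_def eigenvector_def)
    have "x = A * B *\<^sub>v x" using x m by simp
    also have "\<dots> = c \<cdot>\<^sub>v (A *\<^sub>v x)"
      using x m by (subst assoc_mult_mat_vec[of _ n n _ n]) (auto simp: mult_mat_vec)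
    finally have xA: "x = c \<cdot>\<^sub>v (A *\<^sub>v x)" .
    have c: "c \<noteq> 0"
    proof
      assume "c = 0"
      then have "x $ i = 0" if "i < n" for i
        using arg_cong[OF xA, of "\<lambda>y. y $ i"] that m(2) by simp
      then show False using x by (auto simp: vec_eq_iff)
    qed
    have "(1 / c) \<cdot>\<^sub>v x = (1 / c) \<cdot>\<^sub>v (c \<cdot>\<^sub>v (A *\<^sub>v x))" using xA by simp
    then have "A *\<^sub>v x = (1 / c) \<cdot>\<^sub>v x" using c by (simp add: smult_smult_assoc)
    then have "eigenvector A x (1 / c)" using x m by (auto simp: eigenvector_def)
    then show ?thesis using c by (auto simp: eigenvalue_def)
  qed
  show ?thesis using *[OF _ A B AB, of c] *[OF _ B A BA, of "1 / c"] by auto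
qed

text \<open>
  The spectrum of the inverse consists of the reciprocals of the (positive) eigenvalues, which
  reverses their order. The eigenvalue that bounds the Rayleigh quotient from below is the smallest
  one, and it also shows that the set whose maximum is taken is nonempty.
\<close>

lemma largest_eigenvalue_inverse:
  fixes A B :: "real mat"
  assumes A: "A \<in> carrier_mat n n" and sym: "A\<^sup>T = A" and n: "n > 0"
    and psd: "\<And>x. x \<in> carrier_vec n \<Longrightarrow> 0 \<le> x \<bullet> (A *\<^sub>v x)"
    and det: "det A \<noteq> 0"
  obtains \<mu> where "\<mu> > 0" "eigenvalue A \<mu>"
    "\<And>x. x \<in> carrier_vec n \<Longrightarrow> \<mu> * (x \<bullet> x) \<le> x \<bullet> (A *\<^sub>v x)"
    "largest_eigenvalue (the (mat_inverse A)) = 1 / \<mu>"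
proof -
  obtain B where B: "mat_inverse A = Some B" "B \<in> carrier_mat n n" "A * B = 1\<^sub>m n" "B * A = 1\<^sub>m n"
    using nonsingular_inverse[OF A det] by metis
  note ev = eigenvalue_inverse_iff[OF A B(2-4)]
  obtain \<mu> where \<mu>: "eigenvalue A \<mu>" "\<And>x. x \<in> carrier_vec n \<Longrightarrow> \<mu> * (x \<bullet> x) \<le> x \<bullet> (A *\<^sub>v x)"
    using symmetric_least_eigenvalue[OF A sym n] by metis
  have least: "\<mu> \<le> c" "0 < c" if "eigenvalue A c" for c
  proof -
    obtain x where x: "x \<in> carrier_vec n" "x \<noteq> 0\<^sub>v n" "A *\<^sub>v x = c \<cdot>\<^sub>v x"
      using \<open>eigenvalue A c\<close> A by (auto simp: eigenvalue_def eigenvector_def)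
    have xx: "0 < x \<bullet> x" and q: "x \<bullet> (A *\<^sub>v x) = c * (x \<bullet> x)"
      using x by (auto intro: scalar_prod_self_pos)
    show "\<mu> \<le> c" using \<mu>(2)[OF x(1)] xx q by simp
    have "0 \<le> c" using psd[OF x(1)] xx q by (simp add: zero_le_mult_iff)
    moreover have "c \<noteq> 0"
    proof
      assume "c = 0"
      then have "A *\<^sub>v x = 0\<^sub>v n" using x by (auto simp: vec_eq_iff)
      then show False using det x det_0_iff_vec_prod_zero_field[OF A] by blast
    qed
    ultimately show "0 < c" by simp
  qed
  have pos: "\<mu> > 0" using least(2) \<mu>(1) .
  have "Max {c. eigenvalue B c} = 1 / \<mu>"
  proof (rule Max_eqI)
    show "finite {c. eigenvalue B c}"
      using card_finite_spectrum(1)[OF B(2)] by (simp add: spectrum_def)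
    show "1 / \<mu> \<in> {c. eigenvalue B c}" using ev[of "1 / \<mu>"] \<mu>(1) pos by simp
    fix c assume "c \<in> {c. eigenvalue B c}"
    then have c: "eigenvalue A (1 / c)" using ev by simp
    have "0 < c" using least(2)[OF c] by simp
    then show "c \<le> 1 / \<mu>" using least(1)[OF c] pos by (simp add: field_simps)
  qed
  then show thesis using that[OF pos \<mu>] B(1) by (simp add: largest_eigenvalue_def)
qed

section \<open>Information matrices of block designs\<close>

text \<open>
  Both \<open>M\<close> and \<open>N\<close> have the form \<open>diag(r) - W diag(h) W\<^sup>T\<close>, for the full incidence matrix and for
  the one without the control, so their entries are computed together.
\<close>

lemma diag_minus_gram_index:
  fixes r h :: "nat \<Rightarrow> real"
  assumes "i < n" "j < n"
  shows "(mat_diag n r - mat n d w * mat_diag d h * (mat n d w)\<^sup>T) $$ (i, j) =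
    (if i = j then r i else 0) - (\<Sum>k<d. w (i, k) * h k * w (j, k))"
proof -
  have "(mat n d w * mat_diag d h * (mat n d w)\<^sup>T) $$ (i, j) = (\<Sum>k<d. w (i, k) * h k * w (j, k))"
    using assms by (subst mat_diag_mult_right[of _ n]) (auto simp: scalar_prod_def atLeast0LessThan)
  moreover have "mat n d w * mat_diag d h * (mat n d w)\<^sup>T \<in> carrier_mat n n"
    by (intro mult_carrier_mat[of _ n d]) auto
  ultimately show ?thesis using assms by (simp add: mat_diag_def)
qed

lemma diag_minus_gram_carrier:
  "mat_diag n r - mat n d w * mat_diag d h * (mat n d w)\<^sup>T \<in> carrier_mat n (n :: nat)"
  by (intro minus_carrier_mat mult_carrier_mat[of _ n d]) auto

lemma diag_minus_gram_symmetric: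
  fixes r h :: "nat \<Rightarrow> real"
  shows "(mat_diag n r - mat n d w * mat_diag d h * (mat n d w)\<^sup>T)\<^sup>T =
    mat_diag n r - mat n d w * mat_diag d h * (mat n d w)\<^sup>T" (is "?A\<^sup>T = ?A")
proof (rule eq_matI)
  note c = diag_minus_gram_carrier[of n r d w h]
  show "dim_row ?A\<^sup>T = dim_row ?A" "dim_col ?A\<^sup>T = dim_col ?A" using c by simp_all
  fix i j assume "i < dim_row ?A" "j < dim_col ?A"
  then have ij: "i < n" "j < n" using c by simp_all
  have "?A\<^sup>T $$ (i, j) = ?A $$ (j, i)" using c ij by (intro index_transpose_mat) auto
  also have "\<dots> = ?A $$ (i, j)"
    unfolding diag_minus_gram_index[OF ij] diag_minus_gram_index[OF ij(2,1)]
    by (auto simp: mult_ac)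
  finally show "?A\<^sup>T $$ (i, j) = ?A $$ (i, j)" .
qed

lemma diag_minus_gram_mult_vec:
  fixes r h :: "nat \<Rightarrow> real"
  assumes x: "x \<in> carrier_vec n" and i: "i < n"
  shows "((mat_diag n r - mat n d w * mat_diag d h * (mat n d w)\<^sup>T) *\<^sub>v x) $ i =
    r i * x $ i - (\<Sum>k<d. w (i, k) * h k * (\<Sum>j<n. w (j, k) * x $ j))" (is "(?A *\<^sub>v x) $ i = _")
proof -
  have "(?A *\<^sub>v x) $ i = (\<Sum>j<n. ?A $$ (i, j) * x $ j)"
    by (rule mult_mat_vec_sum[OF diag_minus_gram_carrier x i])
  also have "\<dots> = (\<Sum>j<n. (if i = j then r i else 0) * x $ j) -
      (\<Sum>j<n. \<Sum>k<d. w (i, k) * h k * w (j, k) * x $ j)"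
    unfolding sum_subtractf[symmetric]
    by (intro sum.cong) (auto simp: diag_minus_gram_index[OF i] left_diff_distrib sum_distrib_right)
  also have "(\<Sum>j<n. (if i = j then r i else 0) * x $ j) = (\<Sum>j<n. if i = j then r i * x $ i else 0)"
    by (intro sum.cong) auto
  also have "\<dots> = r i * x $ i" using i by simp
  also have "(\<Sum>j<n. \<Sum>k<d. w (i, k) * h k * w (j, k) * x $ j) =
      (\<Sum>k<d. w (i, k) * h k * (\<Sum>j<n. w (j, k) * x $ j))"
    by (subst sum.swap) (simp add: sum_distrib_left mult_ac)
  finally show ?thesis .
qed

lemma replication_Suc: "replication d \<xi> i = (\<Sum>k<d. \<xi> i (Suc k))"
  by (simp add: replication_def sum.atLeast1_atMost_eq)

lemma block_size_split: "block_size v \<xi> k = \<xi> 0 k + (\<Sum>i<v. \<xi> (Suc i) k)"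
  by (simp add: block_size_def atLeast0AtMost sum.atMost_shift)

lemma N_mat_carrier [simp]: "N_mat v d \<xi> \<in> carrier_mat v v"
  unfolding N_mat_def Z_mat_def inv_size_diag_def by (rule diag_minus_gram_carrier)

lemma N_mat_symmetric: "(N_mat v d \<xi>)\<^sup>T = N_mat v d \<xi>"
  unfolding N_mat_def Z_mat_def inv_size_diag_def by (rule diag_minus_gram_symmetric)

lemma M_mat_carrier [simp]: "M_mat v d \<xi> \<in> carrier_mat (Suc v) (Suc v)"
  using diag_minus_gram_carrier[of "Suc v"] unfolding M_mat_def X_mat_def inv_size_diag_def by simp

lemma M_mat_symmetric: "(M_mat v d \<xi>)\<^sup>T = M_mat v d \<xi>"
  unfolding M_mat_def X_mat_def inv_size_diag_def by (rule diag_minus_gram_symmetric)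

lemma N_mat_mult_vec:
  assumes "x \<in> carrier_vec v" "i < v"
  shows "(N_mat v d \<xi> *\<^sub>v x) $ i = replication d \<xi> (Suc i) * x $ i -
    (\<Sum>k<d. \<xi> (Suc i) (Suc k) * inverse (block_size v \<xi> (Suc k)) *
      (\<Sum>j<v. \<xi> (Suc j) (Suc k) * x $ j))"
  using diag_minus_gram_mult_vec[OF assms, of "\<lambda>i. replication d \<xi> (i + 1)" d
      "\<lambda>(i, k). \<xi> (i + 1) (k + 1)" "\<lambda>k. inverse (block_size v \<xi> (k + 1))"]
  unfolding N_mat_def Z_mat_def inv_size_diag_def by simp

lemma M_mat_mult_vec:
  assumes "y \<in> carrier_vec (Suc v)" "i < Suc v"
  shows "(M_mat v d \<xi> *\<^sub>v y) $ i = replication d \<xi> i * y $ i -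
    (\<Sum>k<d. \<xi> i (Suc k) * inverse (block_size v \<xi> (Suc k)) *
      (\<Sum>j<Suc v. \<xi> j (Suc k) * y $ j))"
  using diag_minus_gram_mult_vec[OF assms, of "replication d \<xi>" d
      "\<lambda>(i, k). \<xi> i (k + 1)" "\<lambda>k. inverse (block_size v \<xi> (k + 1))"]
  unfolding M_mat_def X_mat_def inv_size_diag_def by (simp del: sum.lessThan_Suc)

lemma approx_designD:
  assumes "approx_design v d \<xi>"
  shows "i \<le> v \<Longrightarrow> k < d \<Longrightarrow> 0 \<le> \<xi> i (Suc k)"
    and "k < d \<Longrightarrow> 0 < block_size v \<xi> (Suc k)"
    and "(\<Sum>k<d. block_size v \<xi> (Suc k)) = 1"
proof -
  show "i \<le> v \<Longrightarrow> k < d \<Longrightarrow> 0 \<le> \<xi> i (Suc k)" "k < d \<Longrightarrow> 0 < block_size v \<xi> (Suc k)"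
    using assms by (auto simp: approx_design_def)
  have "1 = (\<Sum>i=0..v. \<Sum>k<d. \<xi> i (Suc k))"
    using assms by (simp add: approx_design_def sum.atLeast1_atMost_eq)
  also have "\<dots> = (\<Sum>k<d. block_size v \<xi> (Suc k))"
    unfolding block_size_def by (rule sum.swap)
  finally show "(\<Sum>k<d. block_size v \<xi> (Suc k)) = 1" by simp
qed

text \<open>
  The vector of all ones is in the kernel of the symmetric matrix \<open>M\<close>: adding the same constant to all treatment effects
  is indistinguishable from a shift of the block effects.
\<close>

lemma M_mat_column_sums:
  assumes \<xi>: "approx_design v d \<xi>" and y: "y \<in> carrier_vec (Suc v)"
  shows "(\<Sum>i<Suc v. (M_mat v d \<xi> *\<^sub>v y) $ i) = 0"
proof -
  let ?s = "\<lambda>k. block_size v \<xi> (Suc k)"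
  let ?m = "\<lambda>k. \<Sum>j<Suc v. \<xi> j (Suc k) * y $ j"
  have s: "?s k = (\<Sum>i<Suc v. \<xi> i (Suc k))" for k
    by (simp add: block_size_def atLeast0AtMost lessThan_Suc_atMost del: sum.lessThan_Suc)
  have "(\<Sum>i<Suc v. (M_mat v d \<xi> *\<^sub>v y) $ i) =
      (\<Sum>i<Suc v. replication d \<xi> i * y $ i) -
      (\<Sum>i<Suc v. \<Sum>k<d. \<xi> i (Suc k) * inverse (?s k) * ?m k)"
    unfolding sum_subtractf[symmetric] using y by (intro sum.cong) (auto simp only: M_mat_mult_vec)
  also have "(\<Sum>i<Suc v. \<Sum>k<d. \<xi> i (Suc k) * inverse (?s k) * ?m k) =
      (\<Sum>k<d. ?s k * inverse (?s k) * ?m k)"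
    unfolding s sum_distrib_right by (rule sum.swap)
  also have "\<dots> = (\<Sum>k<d. ?m k)"
    using approx_designD(2)[OF \<xi>] by (intro sum.cong) (auto simp: less_le)
  also have "\<dots> = (\<Sum>i<Suc v. replication d \<xi> i * y $ i)"
    unfolding replication_Suc sum_distrib_right by (rule sum.swap)
  finally show ?thesis by simp
qed

text \<open>
  Deleting the control from \<open>M\<close> leaves \<open>N\<close>, and the control entry is recovered from the vanishing
  sum of the entries of \<open>M y\<close>. Comparing with \<open>Q_mat_mult_vec\<close>, \<open>M (0, x) = Q (N x)\<close>.
\<close>

lemma M_mat_mult_control_zero:
  assumes \<xi>: "approx_design v d \<xi>" and x: "x \<in> carrier_vec v"
  shows "M_mat v d \<xi> *\<^sub>v vCons 0 x =
    vCons (- (\<Sum>i<v. (N_mat v d \<xi> *\<^sub>v x) $ i)) (N_mat v d \<xi> *\<^sub>v x)"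
proof -
  let ?y = "vCons 0 x" and ?M = "M_mat v d \<xi>" and ?N = "N_mat v d \<xi>"
  have y: "?y \<in> carrier_vec (Suc v)" using x by simp
  have low: "(?M *\<^sub>v ?y) $ Suc i = (?N *\<^sub>v x) $ i" if "i < v" for i
    using that x y by (simp only: M_mat_mult_vec N_mat_mult_vec Suc_less_eq sum.lessThan_Suc_shift)
      (simp del: sum.lessThan_Suc)
  have top: "(?M *\<^sub>v ?y) $ 0 = - (\<Sum>i<v. (?N *\<^sub>v x) $ i)"
    using M_mat_column_sums[OF \<xi> y] low
    by (simp add: sum.lessThan_Suc_shift del: sum.lessThan_Suc index_mult_mat_vec)
  have My: "?M *\<^sub>v ?y \<in> carrier_vec (Suc v)" by (rule mult_mat_vec_carrier[OF M_mat_carrier y])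
  have Nx: "?N *\<^sub>v x \<in> carrier_vec v" by (rule mult_mat_vec_carrier[OF N_mat_carrier x])
  show ?thesis
  proof (rule eq_vecI)
    show "dim_vec (?M *\<^sub>v ?y) = dim_vec (vCons (- (\<Sum>i<v. (?N *\<^sub>v x) $ i)) (?N *\<^sub>v x))"
      using My Nx by (metis carrier_vecD vCons_carrier_vec)
    fix i assume "i < dim_vec (vCons (- (\<Sum>i<v. (?N *\<^sub>v x) $ i)) (?N *\<^sub>v x))"
    then have "i < Suc v" using Nx by (metis carrier_vecD vCons_carrier_vec)
    then show "(?M *\<^sub>v ?y) $ i = vCons (- (\<Sum>i<v. (?N *\<^sub>v x) $ i)) (?N *\<^sub>v x) $ i"
      using low top by (cases i) (simp_all del: index_mult_mat_vec)
  qed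
qed

lemma Q_mat_mult_vec:
  assumes "z \<in> carrier_vec v"
  shows "Q_mat v *\<^sub>v z = vCons (- (\<Sum>i<v. z $ i)) z"
proof (rule eq_vecI)
  have Q: "Q_mat v \<in> carrier_mat (Suc v) v" by (simp add: Q_mat_def)
  show "dim_vec (Q_mat v *\<^sub>v z) = dim_vec (vCons (- (\<Sum>i<v. z $ i)) z)"
    using assms by (simp add: Q_mat_def)
  fix i assume "i < dim_vec (vCons (- (\<Sum>i<v. z $ i)) z)"
  then have i: "i < Suc v" using assms by simp
  have "(Q_mat v *\<^sub>v z) $ i = (\<Sum>j<v. (if i = 0 then -1 else if i = j + 1 then 1 else 0) * z $ j)"
    using mult_mat_vec_sum[OF Q assms i] i by (simp add: Q_mat_def)
  also have "\<dots> = vCons (- (\<Sum>i<v. z $ i)) z $ i"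
  proof (cases i)
    case 0
    then show ?thesis by (simp add: sum_negf)
  next
    case (Suc j)
    then have "(\<Sum>j'<v. (if i = 0 then -1 else if i = j' + 1 then 1 else 0) * z $ j') =
        (\<Sum>j'<v. if j = j' then z $ j' else 0)"
      by (intro sum.cong) auto
    then show ?thesis using Suc i by simp
  qed
  finally show "(Q_mat v *\<^sub>v z) $ i = vCons (- (\<Sum>i<v. z $ i)) z $ i" .
qed

lemma feasible_iff:
  "feasible v d \<xi> \<longleftrightarrow> (\<forall>z\<in>carrier_vec v. \<exists>w\<in>carrier_vec (Suc v). M_mat v d \<xi> *\<^sub>v w = Q_mat v *\<^sub>v z)"
proof -
  have Q: "Q_mat v \<in> carrier_mat (Suc v) v" by (simp add: Q_mat_def)
  have Q_space: "vec_space.col_space (Suc v) (Q_mat v) =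
      {y \<in> carrier_vec (Suc v). \<exists>z\<in>carrier_vec v. Q_mat v *\<^sub>v z = y}"
    using vec_space.col_space_eq[OF Q] Q by simp
  have M_space: "vec_space.col_space (Suc v) (M_mat v d \<xi>) =
      {y \<in> carrier_vec (Suc v). \<exists>w\<in>carrier_vec (Suc v). M_mat v d \<xi> *\<^sub>v w = y}"
    using vec_space.col_space_eq[OF M_mat_carrier, of v d \<xi>]
      carrier_matD[OF M_mat_carrier, of v d \<xi>] by simp
  have "Q_mat v *\<^sub>v z \<in> carrier_vec (Suc v)" if "z \<in> carrier_vec v" for z
    using mult_mat_vec_carrier[OF Q that] .
  then show ?thesis
    unfolding feasible_def Suc_eq_plus1[symmetric] Q_space M_space by blast
qed

text \<open>
  If \<open>N x = 0\<close>, then \<open>y = (0, x)\<close> is in the kernel of the symmetric matrix \<open>M\<close> and thus orthogonal to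
  the column space of \<open>M\<close>. A feasible design has \<open>Q x\<close> in this space, and \<open>y\<^sup>T Q x = x\<^sup>T x\<close>.
  Conversely, \<open>M (0, N\<inverse> z) = Q z\<close> for every \<open>z\<close>.
\<close>

lemma feasible_iff_nonsingular:
  assumes \<xi>: "approx_design v d \<xi>"
  shows "feasible v d \<xi> \<longleftrightarrow> det (N_mat v d \<xi>) \<noteq> 0"
proof
  let ?M = "M_mat v d \<xi>" and ?N = "N_mat v d \<xi>"
  assume f: "feasible v d \<xi>"
  show "det ?N \<noteq> 0"
  proof
    assume "det ?N = 0"
    then obtain x where x: "x \<in> carrier_vec v" "x \<noteq> 0\<^sub>v v" "?N *\<^sub>v x = 0\<^sub>v v"
      using det_0_iff_vec_prod_zero_field[OF N_mat_carrier] by blast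
    let ?y = "vCons 0 x"
    have y: "?y \<in> carrier_vec (Suc v)" using x by simp
    have My: "?M *\<^sub>v ?y = 0\<^sub>v (Suc v)"
      using M_mat_mult_control_zero[OF \<xi> x(1)] by (simp add: x(3) zero_vec_Suc)
    obtain w where w: "w \<in> carrier_vec (Suc v)" "?M *\<^sub>v w = Q_mat v *\<^sub>v x"
      using f x(1) by (auto simp: feasible_iff)
    have "x \<bullet> x = ?y \<bullet> (?M *\<^sub>v w)" using x(1) by (simp add: w(2) Q_mat_mult_vec)
    also have "\<dots> = (?M *\<^sub>v ?y) \<bullet> w"
      by (rule symmetric_scalar_prod[OF M_mat_carrier M_mat_symmetric y w(1)])
    also have "\<dots> = 0" using w(1) by (simp add: My)
    finally show False using scalar_prod_self_pos[OF x(1,2)] by simp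
  qed
next
  let ?M = "M_mat v d \<xi>" and ?N = "N_mat v d \<xi>"
  assume "det ?N \<noteq> 0"
  then obtain B where B: "B \<in> carrier_mat v v" "?N * B = 1\<^sub>m v"
    using nonsingular_inverse[OF N_mat_carrier] by metis
  show "feasible v d \<xi>"
    unfolding feasible_iff
  proof
    fix z :: "real vec" assume z: "z \<in> carrier_vec v"
    have Bz: "B *\<^sub>v z \<in> carrier_vec v" using B z by simp
    have "?N *\<^sub>v (B *\<^sub>v z) = z"
      using B z by (simp add: assoc_mult_mat_vec[of _ v v _ v, symmetric])
    then have "?M *\<^sub>v vCons 0 (B *\<^sub>v z) = Q_mat v *\<^sub>v z"
      using M_mat_mult_control_zero[OF \<xi> Bz] z by (simp add: Q_mat_mult_vec)
    then show "\<exists>w\<in>carrier_vec (Suc v). ?M *\<^sub>v w = Q_mat v *\<^sub>v z"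
      using Bz by (intro bexI[of _ "vCons 0 (B *\<^sub>v z)"]) auto
  qed
qed

lemma N_mat_quadratic_form:
  assumes x: "x \<in> carrier_vec v"
  shows "x \<bullet> (N_mat v d \<xi> *\<^sub>v x) = (\<Sum>k<d. (\<Sum>i<v. \<xi> (Suc i) (Suc k) * (x $ i)\<^sup>2) -
    (\<Sum>i<v. \<xi> (Suc i) (Suc k) * x $ i)\<^sup>2 / block_size v \<xi> (Suc k))"
proof -
  let ?s = "\<lambda>k. block_size v \<xi> (Suc k)"
  define m where "m k = (\<Sum>j<v. \<xi> (Suc j) (Suc k) * x $ j)" for k
  have "N_mat v d \<xi> *\<^sub>v x \<in> carrier_vec v" by (rule mult_mat_vec_carrier[OF N_mat_carrier x])
  then have "x \<bullet> (N_mat v d \<xi> *\<^sub>v x) = (\<Sum>i<v. x $ i * (replication d \<xi> (Suc i) * x $ i -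
      (\<Sum>k<d. \<xi> (Suc i) (Suc k) * inverse (?s k) * m k)))"
    using x by (simp add: scalar_prod_sum N_mat_mult_vec m_def del: index_mult_mat_vec)
  also have "\<dots> = (\<Sum>i<v. \<Sum>k<d. \<xi> (Suc i) (Suc k) * (x $ i)\<^sup>2 -
      \<xi> (Suc i) (Suc k) * x $ i * (m k / ?s k))"
    by (intro sum.cong refl) (simp add: replication_Suc sum_distrib_left sum_distrib_right
      right_diff_distrib sum_subtractf power2_eq_square field_simps)
  also have "\<dots> = (\<Sum>k<d. \<Sum>i<v. \<xi> (Suc i) (Suc k) * (x $ i)\<^sup>2 -
      \<xi> (Suc i) (Suc k) * x $ i * (m k / ?s k))" by (rule sum.swap)
  also have "\<dots> = (\<Sum>k<d. (\<Sum>i<v. \<xi> (Suc i) (Suc k) * (x $ i)\<^sup>2) - (m k)\<^sup>2 / ?s k)"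
    by (simp only: sum_subtractf sum_distrib_right[symmetric] m_def[symmetric])
      (simp add: power2_eq_square)
  finally show ?thesis unfolding m_def .
qed

text \<open>
  For positive total weight this is the nonnegativity of the weighted variance.
\<close>

lemma weighted_Cauchy_Schwarz:
  fixes w x :: "'a \<Rightarrow> real"
  assumes fin: "finite I" and w: "\<And>i. i \<in> I \<Longrightarrow> 0 \<le> w i"
  shows "(\<Sum>i\<in>I. w i * x i)\<^sup>2 \<le> (\<Sum>i\<in>I. w i) * (\<Sum>i\<in>I. w i * (x i)\<^sup>2)" (is "?m\<^sup>2 \<le> ?W * ?S")
proof (cases "?W = 0")
  case True
  then have "\<forall>i\<in>I. w i = 0" using sum_nonneg_eq_0_iff[OF fin w] by simp
  then show ?thesis by simp
next
  case False
  then have W: "0 < ?W" using sum_nonneg[of I w] w by (simp add: less_le)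
  \<comment> \<open>The deviations from the mean \<open>?m / ?W\<close> are scaled by \<open>?W\<close> to avoid fractions.\<close>
  have "0 \<le> (\<Sum>i\<in>I. w i * (?W * x i - ?m)\<^sup>2)" using w by (intro sum_nonneg) auto
  also have "\<dots> = (\<Sum>i\<in>I. ?W\<^sup>2 * (w i * (x i)\<^sup>2) - 2 * ?W * ?m * (w i * x i) + ?m\<^sup>2 * w i)"
    by (intro sum.cong refl) (simp add: power2_eq_square algebra_simps)
  also have "\<dots> = ?W\<^sup>2 * ?S - 2 * ?W * ?m * ?m + ?m\<^sup>2 * ?W"
    by (simp only: sum.distrib sum_subtractf sum_distrib_left)
  also have "\<dots> = ?W * (?W * ?S - ?m\<^sup>2)" by (simp add: power2_eq_square algebra_simps)
  finally show ?thesis using W by (simp add: zero_le_mult_iff)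
qed

text \<open>
  In each block, Cauchy-Schwarz is applied with the weights of the test treatments, whose total is
  \<open>s\<^sub>k - \<xi>(0,k)\<close>; the share of the control is what remains. The bound yields positive
  semidefiniteness in general and the eigenvalue bound for half-control blocks.
\<close>

lemma N_mat_quadratic_form_ge:
  assumes \<xi>: "approx_design v d \<xi>" and x: "x \<in> carrier_vec v"
  shows "(\<Sum>k<d. \<xi> 0 (Suc k) / block_size v \<xi> (Suc k) * (\<Sum>i<v. \<xi> (Suc i) (Suc k) * (x $ i)\<^sup>2))
    \<le> x \<bullet> (N_mat v d \<xi> *\<^sub>v x)"
  unfolding N_mat_quadratic_form[OF x]
proof (intro sum_mono)
  fix k assume "k \<in> {..<d}"
  then have k: "k < d" by simp
  let ?s = "block_size v \<xi> (Suc k)" and ?S = "\<Sum>i<v. \<xi> (Suc i) (Suc k) * (x $ i)\<^sup>2"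
  have s: "0 < ?s" using approx_designD(2)[OF \<xi> k] .
  have "(\<Sum>i<v. \<xi> (Suc i) (Suc k) * x $ i)\<^sup>2 \<le> (\<Sum>i<v. \<xi> (Suc i) (Suc k)) * ?S"
    using approx_designD(1)[OF \<xi> _ k] by (intro weighted_Cauchy_Schwarz) auto
  also have "\<dots> = (?s - \<xi> 0 (Suc k)) * ?S" by (simp add: block_size_split)
  finally show "\<xi> 0 (Suc k) / ?s * ?S \<le> ?S - (\<Sum>i<v. \<xi> (Suc i) (Suc k) * x $ i)\<^sup>2 / ?s"
    using s by (simp add: field_simps)
qed

lemma N_mat_psd:
  assumes \<xi>: "approx_design v d \<xi>" and x: "x \<in> carrier_vec v"
  shows "0 \<le> x \<bullet> (N_mat v d \<xi> *\<^sub>v x)"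
proof -
  have "0 \<le> (\<Sum>k<d. \<xi> 0 (Suc k) / block_size v \<xi> (Suc k) * (\<Sum>i<v. \<xi> (Suc i) (Suc k) * (x $ i)\<^sup>2))"
    using approx_designD(1,2)[OF \<xi>]
    by (intro sum_nonneg mult_nonneg_nonneg divide_nonneg_nonneg) (auto simp: less_imp_le)
  also note N_mat_quadratic_form_ge[OF assms]
  finally show ?thesis .
qed

abbreviation ones :: "nat \<Rightarrow> real vec" where
  "ones v \<equiv> vec v (\<lambda>_. 1)"

text \<open>
  Completing the square in \<open>\<xi>(0,k) (s\<^sub>k - \<xi>(0,k)) / s\<^sub>k\<close> gives the value \<open>1/4\<close> minus a penalty that
  vanishes only if the control takes half of every block.
\<close>

lemma N_mat_ones:
  assumes \<xi>: "approx_design v d \<xi>"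
  shows "ones v \<bullet> (N_mat v d \<xi> *\<^sub>v ones v) =
    1 / 4 - (\<Sum>k<d. (\<xi> 0 (Suc k) - block_size v \<xi> (Suc k) / 2)\<^sup>2 / block_size v \<xi> (Suc k))"
proof -
  let ?s = "\<lambda>k. block_size v \<xi> (Suc k)"
  have "ones v \<bullet> (N_mat v d \<xi> *\<^sub>v ones v) =
      (\<Sum>k<d. (\<Sum>i<v. \<xi> (Suc i) (Suc k)) - (\<Sum>i<v. \<xi> (Suc i) (Suc k))\<^sup>2 / ?s k)"
    by (subst N_mat_quadratic_form) auto
  also have "\<dots> = (\<Sum>k<d. ?s k / 4 - (\<xi> 0 (Suc k) - ?s k / 2)\<^sup>2 / ?s k)"
  proof (intro sum.cong refl)
    fix k assume "k \<in> {..<d}"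
    then have s: "?s k \<noteq> 0" using approx_designD(2)[OF \<xi>] by (force simp: less_le)
    have W: "(\<Sum>i<v. \<xi> (Suc i) (Suc k)) = ?s k - \<xi> 0 (Suc k)" by (simp add: block_size_split)
    show "(\<Sum>i<v. \<xi> (Suc i) (Suc k)) - (\<Sum>i<v. \<xi> (Suc i) (Suc k))\<^sup>2 / ?s k =
        ?s k / 4 - (\<xi> 0 (Suc k) - ?s k / 2)\<^sup>2 / ?s k"
      unfolding W using s by (simp add: field_simps power2_eq_square)
  qed
  also have "\<dots> = 1 / 4 - (\<Sum>k<d. (\<xi> 0 (Suc k) - ?s k / 2)\<^sup>2 / ?s k)"
    using approx_designD(3)[OF \<xi>] by (simp add: sum_subtractf flip: sum_divide_distrib)
  finally show ?thesis .
qed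

lemma ones_scalar_prod: "ones v \<bullet> ones v = real v"
  by (simp add: scalar_prod_def)

section \<open>The optimality criterion\<close>

lemma feasible_largest_eigenvalue:
  assumes "v \<ge> 1" and \<xi>: "approx_design v d \<xi>" and "feasible v d \<xi>"
  obtains \<mu> where "\<mu> > 0" "eigenvalue (N_mat v d \<xi>) \<mu>"
    "\<And>x. x \<in> carrier_vec v \<Longrightarrow> \<mu> * (x \<bullet> x) \<le> x \<bullet> (N_mat v d \<xi> *\<^sub>v x)"
    "largest_eigenvalue (N_inv v d \<xi>) = 1 / \<mu>"
  using largest_eigenvalue_inverse[OF N_mat_carrier N_mat_symmetric _ N_mat_psd[OF \<xi>]] assms
  unfolding N_inv_def feasible_iff_nonsingular[OF \<xi>] by (metis less_eq_Suc_le One_nat_def)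

lemma largest_eigenvalue_ge:
  assumes v: "v \<ge> 1" and \<xi>: "approx_design v d \<xi>" and f: "feasible v d \<xi>"
  shows "4 * real v \<le> largest_eigenvalue (N_inv v d \<xi>)"
proof -
  obtain \<mu> where \<mu>: "\<mu> > 0"
    "\<And>x. x \<in> carrier_vec v \<Longrightarrow> \<mu> * (x \<bullet> x) \<le> x \<bullet> (N_mat v d \<xi> *\<^sub>v x)"
    "largest_eigenvalue (N_inv v d \<xi>) = 1 / \<mu>"
    using feasible_largest_eigenvalue[OF assms] by metis
  have "\<mu> * real v \<le> ones v \<bullet> (N_mat v d \<xi> *\<^sub>v ones v)"
    using \<mu>(2)[of "ones v"] by (simp add: ones_scalar_prod)
  also have "\<dots> \<le> 1 / 4"
    unfolding N_mat_ones[OF \<xi>] using approx_designD(2)[OF \<xi>]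
    by (auto intro!: sum_nonneg divide_nonneg_pos)
  finally show ?thesis unfolding \<mu>(3) using \<mu>(1) by (simp add: field_simps)
qed

text \<open>
  Half-control blocks make the factors in \<open>N_mat_quadratic_form_ge\<close> equal to \<open>1/2\<close>; the remaining
  double sum collects to the replications.
\<close>

lemma balanced_quadratic_form_ge:
  assumes \<xi>: "approx_design v d \<xi>"
    and half: "\<And>k. k < d \<Longrightarrow> \<xi> 0 (Suc k) = block_size v \<xi> (Suc k) / 2"
    and rep: "\<And>i. i < v \<Longrightarrow> replication d \<xi> (Suc i) = 1 / (2 * real v)"
    and x: "x \<in> carrier_vec v"
  shows "1 / (4 * real v) * (x \<bullet> x) \<le> x \<bullet> (N_mat v d \<xi> *\<^sub>v x)"
proof -
  have "1 / (4 * real v) * (x \<bullet> x) = (\<Sum>i<v. replication d \<xi> (Suc i) / 2 * (x $ i)\<^sup>2)"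
    using x by (simp add: scalar_prod_sum rep sum_distrib_left power2_eq_square)
  also have "\<dots> = (\<Sum>i<v. \<Sum>k<d. 1 / 2 * (\<xi> (Suc i) (Suc k) * (x $ i)\<^sup>2))"
    by (simp add: replication_Suc sum_divide_distrib sum_distrib_right)
  also have "\<dots> = (\<Sum>k<d. \<Sum>i<v. 1 / 2 * (\<xi> (Suc i) (Suc k) * (x $ i)\<^sup>2))"
    by (rule sum.swap)
  also have "\<dots> = (\<Sum>k<d. \<xi> 0 (Suc k) / block_size v \<xi> (Suc k) *
      (\<Sum>i<v. \<xi> (Suc i) (Suc k) * (x $ i)\<^sup>2))"
  proof (intro sum.cong refl)
    fix k assume "k \<in> {..<d}"
    then have "\<xi> 0 (Suc k) / block_size v \<xi> (Suc k) = 1 / 2"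
      using approx_designD(2)[OF \<xi>, of k] by (simp add: half)
    then show "(\<Sum>i<v. 1 / 2 * (\<xi> (Suc i) (Suc k) * (x $ i)\<^sup>2)) =
        \<xi> 0 (Suc k) / block_size v \<xi> (Suc k) * (\<Sum>i<v. \<xi> (Suc i) (Suc k) * (x $ i)\<^sup>2)"
      by (simp only: sum_distrib_left)
  qed
  also note N_mat_quadratic_form_ge[OF \<xi> x]
  finally show ?thesis .
qed

lemma balanced_feasible:
  assumes v: "v \<ge> 1" and \<xi>: "approx_design v d \<xi>"
    and half: "\<And>k. k < d \<Longrightarrow> \<xi> 0 (Suc k) = block_size v \<xi> (Suc k) / 2"
    and rep: "\<And>i. i < v \<Longrightarrow> replication d \<xi> (Suc i) = 1 / (2 * real v)"
  shows "feasible v d \<xi>" "largest_eigenvalue (N_inv v d \<xi>) \<le> 4 * real v"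
proof -
  let ?N = "N_mat v d \<xi>"
  note ge = balanced_quadratic_form_ge[OF \<xi> half rep]
  show f: "feasible v d \<xi>"
    unfolding feasible_iff_nonsingular[OF \<xi>]
  proof
    assume "det ?N = 0"
    then obtain x where x: "x \<in> carrier_vec v" "x \<noteq> 0\<^sub>v v" "?N *\<^sub>v x = 0\<^sub>v v"
      using det_0_iff_vec_prod_zero_field[OF N_mat_carrier] by blast
    then have "1 / (4 * real v) * (x \<bullet> x) \<le> 0" using ge[OF _ _ x(1)] by simp
    moreover have "0 < 1 / (4 * real v) * (x \<bullet> x)"
      using scalar_prod_self_pos[OF x(1,2)] v by simp
    ultimately show False by linarith
  qed
  obtain \<mu> where \<mu>: "\<mu> > 0" "eigenvalue ?N \<mu>" "largest_eigenvalue (N_inv v d \<xi>) = 1 / \<mu>"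
    using feasible_largest_eigenvalue[OF v \<xi> f] by metis
  obtain x where x: "x \<in> carrier_vec v" "x \<noteq> 0\<^sub>v v" "?N *\<^sub>v x = \<mu> \<cdot>\<^sub>v x"
    using \<mu>(2) carrier_matD(1)[OF N_mat_carrier, of v d \<xi>] unfolding eigenvalue_def eigenvector_def by auto
  have "1 / (4 * real v) * (x \<bullet> x) \<le> \<mu> * (x \<bullet> x)" using ge[OF _ _ x(1)] x by simp
  then have "1 / (4 * real v) \<le> \<mu>"
    using scalar_prod_self_pos[OF x(1,2)] by (simp only: mult_le_cancel_right_pos)
  then show "largest_eigenvalue (N_inv v d \<xi>) \<le> 4 * real v"
    unfolding \<mu>(3) using \<mu>(1) v by (simp add: field_simps)
qed

definition uniform_half_design :: "nat \<Rightarrow> nat \<Rightarrow> design" where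
  "uniform_half_design v d i k = (if i = 0 then 1 / (2 * real d) else 1 / (2 * real v * real d))"

text \<open>
  A witness for every \<open>v\<close> and \<open>d\<close> that the bound \<open>largest_eigenvalue_ge\<close> is attained, so that an
  optimal design has to attain it as well.
\<close>

lemma uniform_half_design:
  assumes "v \<ge> 1" "d \<ge> 1"
  shows "approx_design v d (uniform_half_design v d)"
    and "uniform_half_design v d 0 k = block_size v (uniform_half_design v d) k / 2"
    and "replication d (uniform_half_design v d) (Suc i) = 1 / (2 * real v)"
proof -
  let ?u = "uniform_half_design v d"
  have s: "block_size v ?u k = 1 / real d" for k
    using assms by (simp add: block_size_split uniform_half_design_def field_simps)
  have 1: "(\<Sum>i=0..v. \<Sum>k=1..d. ?u i k) = 1"
    using assms s by (subst sum.swap) (simp add: block_size_def)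
  have "1 \<le> real v" "1 \<le> real d" using assms by simp_all
  then have "1 \<le> real v * real d" using mult_mono[of 1 "real v" 1 "real d"] by simp
  then have "0 \<le> ?u i k \<and> ?u i k \<le> 1" for i k
    using \<open>1 \<le> real d\<close> by (auto simp: uniform_half_design_def divide_le_eq_1)
  with 1 show "approx_design v d ?u" using assms s by (simp add: approx_design_def)
  show "?u 0 k = block_size v ?u k / 2" by (simp add: s uniform_half_design_def)
  show "replication d ?u (Suc i) = 1 / (2 * real v)"
    using assms by (simp add: replication_def uniform_half_design_def)
qed

text \<open>
  At \<open>1\<close> the lower bound of the form by the smallest eigenvalue meets the upper bound \<open>1/4\<close>. The
  penalty of \<open>N_mat_ones\<close> therefore vanishes, and \<open>1\<close> is in the kernel of the positive semidefinite
  matrix \<open>N - 1/(4v) I\<close>; the entries of \<open>N 1\<close> then determine the replications.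
\<close>

lemma largest_eigenvalue_min_imp_balanced:
  assumes v: "v \<ge> 1" and \<xi>: "approx_design v d \<xi>" and f: "feasible v d \<xi>"
    and le: "largest_eigenvalue (N_inv v d \<xi>) \<le> 4 * real v"
  shows "k < d \<Longrightarrow> \<xi> 0 (Suc k) = block_size v \<xi> (Suc k) / 2"
    and "i < v \<Longrightarrow> replication d \<xi> (Suc i) = 1 / (2 * real v)"
proof -
  let ?N = "N_mat v d \<xi>" and ?s = "\<lambda>k. block_size v \<xi> (Suc k)" and ?c = "1 / (4 * real v)"
  obtain \<mu> where \<mu>: "\<mu> > 0" "\<And>x. x \<in> carrier_vec v \<Longrightarrow> \<mu> * (x \<bullet> x) \<le> x \<bullet> (?N *\<^sub>v x)"
    "largest_eigenvalue (N_inv v d \<xi>) = 1 / \<mu>"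
    using feasible_largest_eigenvalue[OF v \<xi> f] by metis
  have c: "?c \<le> \<mu>" using le \<mu>(1) v unfolding \<mu>(3) by (simp add: field_simps)
  have ge: "?c * (x \<bullet> x) \<le> x \<bullet> (?N *\<^sub>v x)" if "x \<in> carrier_vec v" for x
    using mult_right_mono[OF c scalar_prod_self_nonneg[of x]] \<mu>(2)[OF that] by linarith
  let ?dev = "\<lambda>k. (\<xi> 0 (Suc k) - ?s k / 2)\<^sup>2 / ?s k"
  have dev: "0 \<le> ?dev k" if "k < d" for k
    using approx_designD(2)[OF \<xi> that] by simp
  have "1 / 4 \<le> ones v \<bullet> (?N *\<^sub>v ones v)"
    using ge[of "ones v"] v by (simp add: ones_scalar_prod)
  then have "(\<Sum>k<d. ?dev k) \<le> 0" unfolding N_mat_ones[OF \<xi>] by simp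
  then have sum0: "(\<Sum>k<d. ?dev k) = 0" using dev by (intro antisym sum_nonneg) auto
  then have half: "\<xi> 0 (Suc k) = ?s k / 2" if "k < d" for k
    using sum_nonneg_eq_0_iff[of "{..<d}" ?dev] dev that approx_designD(2)[OF \<xi> that] by force
  then show "k < d \<Longrightarrow> \<xi> 0 (Suc k) = ?s k / 2" .
  let ?A = "char_matrix ?N ?c"
  have "?A *\<^sub>v ones v = 0\<^sub>v v"
  proof (rule psd_kernel)
    show "?A \<in> carrier_mat v v" by simp
    show "?A\<^sup>T = ?A" by (rule char_matrix_symmetric[OF N_mat_carrier N_mat_symmetric])
    show "ones v \<in> carrier_vec v" by simp
    show "0 \<le> x \<bullet> (?A *\<^sub>v x)" if "x \<in> carrier_vec v" for x
      using ge[OF that] by (simp add: char_matrix_quadratic_form[OF N_mat_carrier that])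
    show "ones v \<bullet> (?A *\<^sub>v ones v) = 0"
      using v sum0 by (simp add: char_matrix_quadratic_form[OF N_mat_carrier] N_mat_ones[OF \<xi>]
          ones_scalar_prod)
  qed
  then have N1: "?N *\<^sub>v ones v - ?c \<cdot>\<^sub>v ones v = 0\<^sub>v v"
    by (simp add: char_matrix_mult_vec[OF N_mat_carrier])
  assume i: "i < v"
  have "(?N *\<^sub>v ones v) $ i = ?c"
    using arg_cong[OF N1, of "\<lambda>y. y $ i"] i by (simp del: index_mult_mat_vec)
  moreover have "(?N *\<^sub>v ones v) $ i = replication d \<xi> (Suc i) -
      (\<Sum>k<d. \<xi> (Suc i) (Suc k) * inverse (?s k) * (?s k - \<xi> 0 (Suc k)))"
    using i by (subst N_mat_mult_vec) (auto simp: block_size_split)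
  moreover have "(\<Sum>k<d. \<xi> (Suc i) (Suc k) * inverse (?s k) * (?s k - \<xi> 0 (Suc k))) =
      (\<Sum>k<d. \<xi> (Suc i) (Suc k) / 2)"
    using approx_designD(2)[OF \<xi>] by (intro sum.cong) (auto simp: half less_le field_simps)
  ultimately show "replication d \<xi> (Suc i) = 1 / (2 * real v)"
    by (simp add: replication_Suc flip: sum_divide_distrib)
qed

theorem theorem1:
  fixes v d :: nat and \<xi> :: design
  assumes "v \<ge> 1" and "d \<ge> 1" and "approx_design v d \<xi>"
  shows "E_optimal v d \<xi> \<longleftrightarrow>
    (\<forall>k\<in>{1..d}. \<xi> 0 k = block_size v \<xi> k / 2) \<and>
    (\<forall>i\<in>{1..v}. replication d \<xi> i = 1 / (2 * real v))"
proof -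
  have shift: "(\<forall>k\<in>{1..n}. P k) \<longleftrightarrow> (\<forall>k<n. P (Suc k))" for n P
    by (simp only: Suc_le_eq One_nat_def Ball_def atLeastAtMost_iff)
      (metis Suc_le_eq Suc_pred zero_less_Suc)
  let ?u = "uniform_half_design v d"
  note u = uniform_half_design[OF assms(1,2)]
  note uf = balanced_feasible[OF assms(1) u]
  have "E_optimal v d \<xi> \<longleftrightarrow> feasible v d \<xi> \<and> largest_eigenvalue (N_inv v d \<xi>) \<le> 4 * real v"
    unfolding E_optimal_def using assms(3) u(1) uf largest_eigenvalue_ge[OF assms(1)]
    by (meson order_trans)
  also have "\<dots> \<longleftrightarrow> (\<forall>k<d. \<xi> 0 (Suc k) = block_size v \<xi> (Suc k) / 2) \<and>
      (\<forall>i<v. replication d \<xi> (Suc i) = 1 / (2 * real v))"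
    using largest_eigenvalue_min_imp_balanced[OF assms(1,3)] balanced_feasible[OF assms(1,3)] by blast
  finally show ?thesis unfolding shift .
qed

end
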